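(* Let $N$ be an even integer, and let the regions $A,B,S_1,S_2$ of the $N\times N$ toric grid be vertical strips of widths $n,m,k,k$ respectively, as in the context, with $3\le n\le m$ and $1\le k<N/2$. Let $\alpha>0$ be the parameter of the Hamiltonian $H$. Then the minimum of the Hamiltonian on $\mathcal{X}$ is $$\min_{\sigma\in\mathcal{X}}H(\sigma)=\begin{cases}-N(n+m)+2\alpha N-\alpha N^2 & \text{if } 2\le\alpha<n,\\ N(n-m)-\alpha N^2 & \text{if }\alpha\ge n,\end{cases}$$ and the set $\mathcal{X}^{stab}$ of global minimizers of $H$ (stable configurations) is $$\mathcal{X}^{stab}=\begin{cases}\{\sigma_{\mathscr{A}_{\ell,p}}: 0\le \ell,p\le k\} & \text{if } 2\le\alpha<n,\\ \{\mathbf{-1},\mathbf{+1}\}\cup\{\sigma_{\mathscr{A}_{\ell,p}}: 0\le \ell,p\le k\} & \text{if }\alpha=n\text{ and }n=m,\\ \{\mathbf{-1}\}\cup\{\sigma_{\mathscr{A}_{\ell,p}}: 0\le \ell,p\le k\} & \text{if }\alpha=n\text{ and }n<m,\\ \{\mathbf{-1},\mathbf{+1}\} & \text{if }\alpha\ge m+1\text{ and }n=m,\\ \{\mathbf{-1}\} & \text{if }\alpha\ge m+1\text{ and }n<m.\end{cases}$$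
   Context: Let $V=\{(i,j)\in\mathbb{Z}^2: 1\le i,j\le N\}$ be the vertex set of the $N\times N$ grid graph with periodic boundary conditions (toric grid), $N$ even, with edge set $E$ (each vertex has four neighbours; each unordered pair of neighbours counted once). The columns of the torus are partitioned, in cyclic order, into four vertical strips (unions of consecutive full columns) $A,S_1,B,S_2$ of widths $n,k,m,k$, so $N=n+m+2k$, and $S_1$ and $S_2$ each separate $A$ from $B$. Configurations are $\sigma=(\sigma_i)_{i\in V}\in\mathcal{X}=\{-1,+1\}^V$, with Hamiltonian $$H(\sigma)=-\sum_{i\in A}\sigma_i+\sum_{i\in B}\sigma_i-\frac{\alpha}{2}\sum_{(i,j)\in E}\sigma_i\sigma_j .$$ $\mathbf{+1}$ and $\mathbf{-1}$ are the constant configurations. For $\bar V\subset V$, $\sigma_{\bar V}$ is the configuration equal to $+1$ on $\bar V$ and $-1$ on $V\setminus\bar V$. With $d$ the lattice (graph) distance, for $0\le\ell,p\le k$, $$\mathscr{A}_{\ell,p}=A\cup\{i\in S_1: d(i,A)\le\ell\}\cup\{i\in S_2: d(i,A)\le p\},$$ i.e. $A$ together with the $\ell$ columns of $S_1$ and the $p$ columns of $S_2$ closest to $A$. *)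

theory Defs
  imports Complex_Main "HOL-Library.FuncSet" "HOL-Number_Theory.Cong"
begin

text \<open>A vertex \<open>(i, j)\<close> lies in row \<open>i\<close> and column \<open>j\<close>.\<close>

definition torus_vertices :: "nat \<Rightarrow> (int \<times> int) set" where
  "torus_vertices N = {1..int N} \<times> {1..int N}"

definition cyclic_neighbours :: "nat \<Rightarrow> int \<Rightarrow> int \<Rightarrow> bool" where
  "cyclic_neighbours N x y \<longleftrightarrow> [y = x + 1] (mod int N) \<or> [x = y + 1] (mod int N)"

definition torus_adj :: "nat \<Rightarrow> ((int \<times> int) \<times> (int \<times> int)) set" where
  "torus_adj N = {((i, j), (i', j')).
     (i, j) \<in> torus_vertices N \<and> (i', j') \<in> torus_vertices N \<and>
     (i = i' \<and> cyclic_neighbours N j j' \<or> j = j' \<and> cyclic_neighbours N i i')}"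

text \<open>Edges are unordered pairs. For \<open>N \<ge> 3\<close> each is a two-element set and each vertex
  has exactly four neighbours.\<close>

definition torus_edges :: "nat \<Rightarrow> (int \<times> int) set set" where
  "torus_edges N = {{u, v} | u v. (u, v) \<in> torus_adj N}"

text \<open>The length of a shortest walk; a walk of length \<open>r\<close> from \<open>u\<close> to \<open>v\<close> is witnessed by
  the \<open>r\<close>-th relational power of the adjacency relation.\<close>

definition torus_dist :: "nat \<Rightarrow> int \<times> int \<Rightarrow> int \<times> int \<Rightarrow> nat" where
  "torus_dist N u v = (LEAST r. (u, v) \<in> torus_adj N ^^ r)"

definition torus_setdist :: "nat \<Rightarrow> int \<times> int \<Rightarrow> (int \<times> int) set \<Rightarrow> nat" where
  "torus_setdist N u U = (INF v\<in>U. torus_dist N u v)"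

text \<open>The \<open>w\<close> consecutive full columns \<open>c, c + 1, \<dots>, c + w - 1\<close>, column numbers being read
  modulo \<open>N\<close>.\<close>

definition strip :: "nat \<Rightarrow> int \<Rightarrow> nat \<Rightarrow> (int \<times> int) set" where
  "strip N c w = {(i, j) \<in> torus_vertices N. (j - c) mod int N < int w}"

definition configs :: "nat \<Rightarrow> (int \<times> int \<Rightarrow> real) set" where
  "configs N = torus_vertices N \<rightarrow>\<^sub>E {-1, 1}"

definition const_config :: "nat \<Rightarrow> real \<Rightarrow> int \<times> int \<Rightarrow> real" where
  "const_config N c = (\<lambda>v\<in>torus_vertices N. c)"

definition set_config :: "nat \<Rightarrow> (int \<times> int) set \<Rightarrow> int \<times> int \<Rightarrow> real" where
  "set_config N U = (\<lambda>v\<in>torus_vertices N. if v \<in> U then 1 else -1)"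

text \<open>For an edge \<open>e = {i, j}\<close> the inner product is \<open>\<sigma> i * \<sigma> j\<close>.\<close>

definition hamiltonian ::
    "nat \<Rightarrow> (int \<times> int) set \<Rightarrow> (int \<times> int) set \<Rightarrow> real \<Rightarrow> (int \<times> int \<Rightarrow> real) \<Rightarrow> real" where
  "hamiltonian N A B \<alpha> \<sigma> =
     - (\<Sum>v\<in>A. \<sigma> v) + (\<Sum>v\<in>B. \<sigma> v) - \<alpha> / 2 * (\<Sum>e\<in>torus_edges N. \<Prod>v\<in>e. \<sigma> v)"

definition stable_configs ::
    "nat \<Rightarrow> (int \<times> int) set \<Rightarrow> (int \<times> int) set \<Rightarrow> real \<Rightarrow> (int \<times> int \<Rightarrow> real) set" where
  "stable_configs N A B \<alpha> =
     {\<sigma> \<in> configs N. \<forall>\<tau>\<in>configs N. hamiltonian N A B \<alpha> \<sigma> \<le> hamiltonian N A B \<alpha> \<tau>}"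

definition enlarged ::
    "nat \<Rightarrow> (int \<times> int) set \<Rightarrow> (int \<times> int) set \<Rightarrow> (int \<times> int) set \<Rightarrow> nat \<Rightarrow> nat \<Rightarrow> (int \<times> int) set" where
  "enlarged N A S\<^sub>1 S\<^sub>2 l p =
     A \<union> {v \<in> S\<^sub>1. torus_setdist N v A \<le> l} \<union> {v \<in> S\<^sub>2. torus_setdist N v A \<le> p}"

end

theory Submission
  imports Defs
begin

text \<open>The Hamiltonian is the sum of the energies of the \<open>N\<close> rows, each made up of its external
  field and its horizontal edges, and of the energy of the vertical edges, which is minimal exactly
  when all rows agree. Compared with a row following the field and having no sign changes, a constant
  row loses at least \<open>2 * n\<close> in the field, whereas a non-constant row, being cyclic, has at least two
  sign changes and loses at least \<open>2 * \<alpha>\<close>. So every row loses at least \<open>2 * min \<alpha> n\<close>. Equality for a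
  non-constant row means that it has exactly two sign changes, is \<open>1\<close> on \<open>A\<close> and \<open>-1\<close> on \<open>B\<close>, which
  makes it a band around \<open>A\<close>.\<close>

section \<open>Columns and edges of the torus\<close>

text \<open>Cyclic successor on the representatives \<open>1..N\<close>: reducing before adding 1
  sends \<open>N\<close> to 1 rather than to 0.\<close>

definition torus_succ :: "nat \<Rightarrow> int \<Rightarrow> int" where
  "torus_succ N x = x mod int N + 1"

lemma torus_succ_eq:
  assumes "x \<in> {1..int N}"
  shows "torus_succ N x = (if x = int N then 1 else x + 1)"
  using assms by (auto simp: torus_succ_def)

lemma torus_succ_mem: "x \<in> {1..int N} \<Longrightarrow> torus_succ N x \<in> {1..int N}"
  by (auto simp: torus_succ_eq)

lemma torus_succ_neq: "x \<in> {1..int N} \<Longrightarrow> 2 \<le> N \<Longrightarrow> torus_succ N x \<noteq> x"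
  by (auto simp: torus_succ_eq)

text \<open>On a cycle of length at least 3 two steps forward never return. This is what will keep
  edges issuing from different vertices distinct.\<close>

lemma torus_succ_torus_succ_neq:
  "x \<in> {1..int N} \<Longrightarrow> 3 \<le> N \<Longrightarrow> torus_succ N (torus_succ N x) \<noteq> x"
  by (auto simp: torus_succ_eq torus_succ_mem split: if_splits)

text \<open>Since \<open>v - 1\<close> is already reduced modulo \<open>N\<close> for
  \<open>v\<close> in \<open>1..N\<close>, each congruence becomes an equation with the cyclic
  successor.\<close>

lemma cyclic_neighbours_iff:
  assumes "x \<in> {1..int N}" "y \<in> {1..int N}"
  shows "cyclic_neighbours N x y \<longleftrightarrow> y = torus_succ N x \<or> x = torus_succ N y"
proof -
  have *: "[v = u + 1] (mod int N) \<longleftrightarrow> v = torus_succ N u"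
    if u: "u \<in> {1..int N}" and v: "v \<in> {1..int N}" for u v
  proof -
    have "[v = u + 1] (mod int N) \<longleftrightarrow> [v - 1 = u] (mod int N)"
      by (simp add: cong_iff_dvd_diff algebra_simps)
    also have "\<dots> \<longleftrightarrow> v - 1 = u mod int N"
      using v by (simp add: cong_def)
    finally show ?thesis
      by (auto simp: torus_succ_def)
  qed
  show ?thesis
    using assms by (simp add: cyclic_neighbours_def *)
qed

text \<open>Orienting every edge from a vertex to its cyclic successor in the same row or column
  gives a parametrisation of the edges by two copies of the vertex set.\<close>

lemma torus_edges_eq:
  "torus_edges N =
     (\<lambda>(i, j). {(i, j), (i, torus_succ N j)}) ` torus_vertices N \<union>
     (\<lambda>(i, j). {(i, j), (torus_succ N i, j)}) ` torus_vertices N" (is "_ = ?R")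
proof (intro set_eqI iffI)
  fix e assume "e \<in> torus_edges N"
  then obtain i j i' j' where e: "e = {(i, j), (i', j')}"
    and mem: "i \<in> {1..int N}" "j \<in> {1..int N}" "i' \<in> {1..int N}" "j' \<in> {1..int N}"
    and adj: "i = i' \<and> cyclic_neighbours N j j' \<or> j = j' \<and> cyclic_neighbours N i i'"
    unfolding torus_edges_def torus_adj_def torus_vertices_def by auto
  from adj mem consider "i = i'" "j' = torus_succ N j" | "i = i'" "j = torus_succ N j'"
    | "j = j'" "i' = torus_succ N i" | "j = j'" "i = torus_succ N i'"
    by (auto simp: cyclic_neighbours_iff)
  then show "e \<in> ?R"
  proof cases
    case 1 then show ?thesis
      using mem unfolding e torus_vertices_def by (intro UnI1 image_eqI[where x = "(i, j)"]) auto
  next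
    case 2 then show ?thesis
      using mem unfolding e torus_vertices_def by (intro UnI1 image_eqI[where x = "(i, j')"]) auto
  next
    case 3 then show ?thesis
      using mem unfolding e torus_vertices_def by (intro UnI2 image_eqI[where x = "(i, j)"]) auto
  next
    case 4 then show ?thesis
      using mem unfolding e torus_vertices_def by (intro UnI2 image_eqI[where x = "(i', j)"]) auto
  qed
next
  fix e assume "e \<in> ?R"
  then obtain i j where mem: "i \<in> {1..int N}" "j \<in> {1..int N}"
    and e: "e = {(i, j), (i, torus_succ N j)} \<or> e = {(i, j), (torus_succ N i, j)}"
    unfolding torus_vertices_def by blast
  have "((i, j), (i, torus_succ N j)) \<in> torus_adj N" "((i, j), (torus_succ N i, j)) \<in> torus_adj N"
    using mem mem[THEN torus_succ_mem] by (simp_all add: torus_adj_def torus_vertices_def cyclic_neighbours_iff)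
  with e show "e \<in> torus_edges N"
    unfolding torus_edges_def by blast
qed

text \<open>For \<open>N \<ge> 3\<close> the two parametrisations are injective with disjoint
  images, so every unordered edge is counted exactly once.\<close>

lemma sum_torus_edges:
  fixes F :: "(int \<times> int) set \<Rightarrow> real"
  assumes N: "3 \<le> N"
  shows "(\<Sum>e\<in>torus_edges N. F e) =
    (\<Sum>i\<in>{1..int N}. \<Sum>j\<in>{1..int N}. F {(i, j), (i, torus_succ N j)}) +
    (\<Sum>i\<in>{1..int N}. \<Sum>j\<in>{1..int N}. F {(i, j), (torus_succ N i, j)})"
proof -
  let ?V = "torus_vertices N"
  let ?h = "\<lambda>(i, j). {(i, j), (i, torus_succ N j)}"
  let ?v = "\<lambda>(i, j). {(i, j), (torus_succ N i, j)}"
  \<comment> \<open>Equal two-element sets have equal or exchanged starting points; an exchange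
    would make two successor steps return to the start.\<close>
  have inj_h: "inj_on ?h ?V"
    using N torus_succ_torus_succ_neq
    by (fastforce intro!: inj_onI simp: torus_vertices_def doubleton_eq_iff)
  have inj_v: "inj_on ?v ?V"
    using N torus_succ_torus_succ_neq
    by (fastforce intro!: inj_onI simp: torus_vertices_def doubleton_eq_iff)
  \<comment> \<open>A common edge would be constant in one coordinate and move in that same
    coordinate, but \<open>torus_succ\<close> has no fixed point.\<close>
  have "?h ` ?V \<inter> ?v ` ?V = {}"
    using N torus_succ_neq by (fastforce simp: torus_vertices_def doubleton_eq_iff)
  then have "(\<Sum>e\<in>torus_edges N. F e) = (\<Sum>e\<in>?h ` ?V. F e) + (\<Sum>e\<in>?v ` ?V. F e)"
    unfolding torus_edges_eq by (intro sum.union_disjoint) (auto simp: torus_vertices_def)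
  also have "(\<Sum>e\<in>?h ` ?V. F e) = (\<Sum>x\<in>?V. F (?h x))"
    using inj_h by (simp add: sum.reindex)
  also have "(\<Sum>e\<in>?v ` ?V. F e) = (\<Sum>x\<in>?V. F (?v x))"
    using inj_v by (simp add: sum.reindex)
  finally show ?thesis
    by (simp add: torus_vertices_def sum.cartesian_product case_prod_unfold)
qed

section \<open>Positions of columns counted cyclically from a starting column\<close>

definition torus_column :: "nat \<Rightarrow> int \<Rightarrow> nat \<Rightarrow> int" where
  "torus_column N c t = (c - 1 + int t) mod int N + 1"

lemma torus_column_mem:
  assumes "0 < N"
  shows "torus_column N c t \<in> {1..int N}"
proof -
  have "0 \<le> (c - 1 + int t) mod int N" "(c - 1 + int t) mod int N < int N"
    using assms by simp_all
  then show ?thesis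
    unfolding torus_column_def atLeastAtMost_iff by linarith
qed

lemma torus_column_shift: "torus_column N (c + int s) t = torus_column N c (s + t)"
  by (simp add: torus_column_def algebra_simps)

lemma torus_column_Suc: "torus_column N c (Suc t) = torus_succ N (torus_column N c t)"
proof -
  have "c - 1 + int (Suc t) = c - 1 + int t + 1" by simp
  then show ?thesis
    by (simp only: torus_column_def torus_succ_def mod_add_left_eq)
qed

lemma torus_column_period: "torus_column N c N = torus_column N c 0"
  by (simp add: torus_column_def)

text \<open>Together with \<open>torus_column_of_offset\<close> this makes position and column
  mutually inverse, whence injectivity and surjectivity of the enumeration.\<close>

lemma torus_column_offset:
  assumes "t < N"
  shows "nat ((torus_column N c t - c) mod int N) = t"
proof -
  have "(torus_column N c t - c) mod int N = ((c - 1 + int t) mod int N - (c - 1)) mod int N"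
    by (simp add: torus_column_def algebra_simps)
  also have "\<dots> = int t"
    using assms by (simp add: mod_diff_left_eq)
  finally show ?thesis by simp
qed

lemma torus_column_of_offset:
  assumes "j \<in> {1..int N}"
  shows "torus_column N c (nat ((j - c) mod int N)) = j"
proof -
  have "torus_column N c (nat ((j - c) mod int N)) = (c - 1 + (j - c) mod int N) mod int N + 1"
    using assms by (simp add: torus_column_def)
  also have "\<dots> = j"
    using assms by (simp add: mod_add_right_eq)
  finally show ?thesis .
qed

lemma inj_on_torus_column: "inj_on (torus_column N c) {..<N}"
  by (rule inj_on_inverseI[where g = "\<lambda>j. nat ((j - c) mod int N)"]) (simp add: torus_column_offset)

text \<open>The product form lets sums over a strip split into rows and, within each row, into
  consecutive positions.\<close>

lemma strip_eq:
  assumes "0 < N" "w \<le> N"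
  shows "strip N c w = {1..int N} \<times> torus_column N c ` {..<w}"
proof -
  have "j \<in> {1..int N} \<and> (j - c) mod int N < int w \<longleftrightarrow> j \<in> torus_column N c ` {..<w}" for j
  proof
    assume j: "j \<in> {1..int N} \<and> (j - c) mod int N < int w"
    then have "nat ((j - c) mod int N) < w"
      using assms by (simp add: nat_less_iff)
    with j show "j \<in> torus_column N c ` {..<w}"
      by (metis image_eqI lessThan_iff torus_column_of_offset)
  next
    assume "j \<in> torus_column N c ` {..<w}"
    then obtain t where t: "t < w" "j = torus_column N c t" by auto
    then have "nat ((j - c) mod int N) < w"
      using assms by (simp add: torus_column_offset)
    with t assms show "j \<in> {1..int N} \<and> (j - c) mod int N < int w"
      using torus_column_mem by auto
  qed
  then show ?thesis
    by (auto simp: strip_def torus_vertices_def)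
qed

lemma sum_strip:
  fixes h :: "int \<times> int \<Rightarrow> real"
  assumes "0 < N" "w \<le> N"
  shows "(\<Sum>v\<in>strip N c w. h v) = (\<Sum>i\<in>{1..int N}. \<Sum>t<w. h (i, torus_column N c t))"
proof -
  have "inj_on (torus_column N c) {..<w}"
    using inj_on_torus_column by (rule inj_on_subset) (use assms in auto)
  then show ?thesis
    using assms by (simp add: strip_eq sum.reindex sum.cartesian_product')
qed

lemma torus_column_image:
  assumes "0 < N"
  shows "torus_column N c ` {..<N} = {1..int N}"
proof
  show "{1..int N} \<subseteq> torus_column N c ` {..<N}"
  proof
    fix j assume "j \<in> {1..int N}"
    then show "j \<in> torus_column N c ` {..<N}"
      using assms by (intro image_eqI[where x = "nat ((j - c) mod int N)"])
        (simp_all add: torus_column_of_offset nat_less_iff)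
  qed
qed (use torus_column_mem assms in blast)

lemma sum_torus_columns:
  fixes h :: "int \<Rightarrow> real"
  assumes "0 < N"
  shows "(\<Sum>j\<in>{1..int N}. h j) = (\<Sum>t<N. h (torus_column N c t))"
  using sum.reindex[OF inj_on_torus_column, of h N c] torus_column_image[OF assms, of c]
  by simp

section \<open>The energy of a row\<close>

text \<open>A row is read off starting at the first column of \<open>A\<close>, so that its cyclic structure is
  expressed by \<open>g N = g 0\<close> and \<open>A\<close>, \<open>S\<^sub>1\<close>, \<open>B\<close>, \<open>S\<^sub>2\<close> occupy consecutive intervals of positions.\<close>

definition row_energy :: "nat \<Rightarrow> nat \<Rightarrow> nat \<Rightarrow> real \<Rightarrow> (nat \<Rightarrow> real) \<Rightarrow> real" where
  "row_energy n m k \<alpha> g =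
     - (\<Sum>t<n. g t) + (\<Sum>t<m. g (n + k + t))
     - \<alpha> / 2 * (\<Sum>t<n + m + 2 * k. g t * g (Suc t))"

text \<open>The value of a row following the field without any sign change, raised by the
  unavoidable loss \<open>2 * min \<alpha> n\<close>.\<close>

definition row_min :: "nat \<Rightarrow> nat \<Rightarrow> nat \<Rightarrow> real \<Rightarrow> real" where
  "row_min n m k \<alpha> = 2 * min \<alpha> (real n) - (real n + real m) - \<alpha> / 2 * (real n + real m + 2 * real k)"

text \<open>The value is 1 on \<open>A\<close>, on the first \<open>l\<close> positions of
  \<open>S\<^sub>1\<close> and on the last \<open>p\<close> positions of \<open>S\<^sub>2\<close>,
  cyclically one interval. Adding \<open>p\<close> on the right avoids truncated
  subtraction.\<close>

definition band_row :: "nat \<Rightarrow> nat \<Rightarrow> nat \<Rightarrow> nat \<Rightarrow> nat \<Rightarrow> nat \<Rightarrow> real" where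
  "band_row n m k l p t = (if t < n + l \<or> n + m + 2 * k \<le> t + p then 1 else -1)"

section \<open>Sign changes in a sequence and termwise lower bounds of sums\<close>

lemma exists_change:
  fixes g :: "nat \<Rightarrow> real"
  assumes "x \<le> y" "g x \<noteq> g y"
  shows "\<exists>t. x \<le> t \<and> t < y \<and> g t \<noteq> g (Suc t)"
proof (rule ccontr)
  assume *: "\<not> ?thesis"
  have "x \<le> s \<Longrightarrow> s \<le> y \<Longrightarrow> g s = g x" for s
    by (induction s rule: dec_induct) (use * in auto)
  from this[of y] assms show False by simp
qed

lemma const_between:
  fixes g :: "nat \<Rightarrow> real"
  assumes "\<And>t. x \<le> t \<Longrightarrow> t < y \<Longrightarrow> g t = g (Suc t)" "x \<le> s" "s \<le> y"
  shows "g s = g x"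
  using exists_change[of x s g] assms by (metis less_le_trans)

text \<open>Subtracting \<open>c\<close> from every term leaves a sum of nonnegative terms, which
  vanishes only if each term does. It serves both for the vertical edges of one row and for the sum
  over all rows.\<close>

lemma sum_le_eq_iff:
  fixes f :: "'a \<Rightarrow> real"
  assumes "finite S" "\<And>x. x \<in> S \<Longrightarrow> c \<le> f x"
  shows "real (card S) * c \<le> sum f S"
    and "sum f S = real (card S) * c \<longleftrightarrow> (\<forall>x\<in>S. f x = c)"
proof -
  have nonneg: "0 \<le> f x - c" if "x \<in> S" for x using assms that by simp
  have "sum f S - real (card S) * c = (\<Sum>x\<in>S. f x - c)"
    by (simp add: sum_subtractf)
  moreover have "0 \<le> (\<Sum>x\<in>S. f x - c)" using nonneg by (rule sum_nonneg)
  moreover have "(\<Sum>x\<in>S. f x - c) = 0 \<longleftrightarrow> (\<forall>x\<in>S. f x - c = 0)"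
    using assms nonneg by (intro sum_nonneg_eq_0_iff) auto
  ultimately show "real (card S) * c \<le> sum f S"
    and "sum f S = real (card S) * c \<longleftrightarrow> (\<forall>x\<in>S. f x = c)" by auto
qed

lemma row_energy_const:
  assumes "\<And>t. t \<le> n + m + 2 * k \<Longrightarrow> g t = c" "c = 1 \<or> c = -1"
  shows "row_energy n m k \<alpha> g = c * (real m - real n) - \<alpha> / 2 * (real n + real m + 2 * real k)"
proof -
  have "(\<Sum>t<n. g t) = (\<Sum>t<n. c)" "(\<Sum>t<m. g (n + k + t)) = (\<Sum>t<m. c)"
    "(\<Sum>t<n + m + 2 * k. g t * g (Suc t)) = (\<Sum>t<n + m + 2 * k. 1)"
    using assms by (auto intro!: sum.cong)
  then show ?thesis
    by (simp add: row_energy_def algebra_simps)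
qed

text \<open>After two sign changes are accounted for, the excess over the bound is a sum of three
  nonnegative parts: wrong signs on \<open>A\<close>, wrong signs on \<open>B\<close>, and further
  sign changes. Equality forces all three to vanish, which leaves a band.\<close>

lemma row_energy_nonconst:
  assumes sgn: "\<And>t. t \<le> N \<Longrightarrow> g t = 1 \<or> g t = (-1::real)" and N: "N = n + m + 2 * k"
    and per: "g N = g 0" and \<alpha>: "0 < \<alpha>" and y: "y < N" "g y \<noteq> g 0" and pos: "0 < n" "0 < m"
  shows "2 * \<alpha> - (real n + real m) - \<alpha> / 2 * real N \<le> row_energy n m k \<alpha> g"
    and "row_energy n m k \<alpha> g = 2 * \<alpha> - (real n + real m) - \<alpha> / 2 * real N \<longleftrightarrow>
      (\<exists>l\<le>k. \<exists>p\<le>k. \<forall>t<N. g t = band_row n m k l p t)"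
proof -
  \<comment> \<open>The sequence changes before \<open>y\<close>, and again from \<open>y\<close> on
    because it must return to \<open>g 0\<close> at \<open>N\<close>; so \<open>p\<close> and
    \<open>q\<close> are distinct.\<close>
  obtain p where p: "p < y" "g p \<noteq> g (Suc p)"
    using exists_change[of 0 y g] y by auto
  obtain q where q: "y \<le> q" "q < N" "g q \<noteq> g (Suc q)"
    using exists_change[of y N g] y per by auto
  \<comment> \<open>\<open>d\<close> is 2 at a sign change and 0 elsewhere; \<open>R\<close>
    collects the positions other than the two known changes. These two contribute 4 to the sum of
    \<open>d\<close>, hence \<open>2 * \<alpha>\<close> to the energy.\<close>
  define d where "d t = 1 - g t * g (Suc t)" for t
  define R where "R = {..<N} - {p, q}"
  have val: "d t = (if g t = g (Suc t) then 0 else 2)" if "t < N" for t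
    using sgn[of t] sgn[of "Suc t"] that by (auto simp: d_def)
  have "(\<Sum>t<N. d t) = (\<Sum>t\<in>{p, q}. d t) + (\<Sum>t\<in>R. d t)"
    unfolding R_def using p q by (subst sum.subset_diff[of "{p, q}"]) auto
  also have "(\<Sum>t\<in>{p, q}. d t) = 4"
    using p q by (simp add: val)
  finally have d_sum: "(\<Sum>t<N. g t * g (Suc t)) = real N - 4 - (\<Sum>t\<in>R. d t)"
    by (simp add: d_def sum_subtractf)
  have A: "- (\<Sum>t<n. g t) = (\<Sum>t<n. 1 - g t) - real n" by (simp add: sum_subtractf)
  have B: "(\<Sum>t<m. g (n + k + t)) = (\<Sum>t<m. 1 + g (n + k + t)) - real m" by (simp add: sum.distrib)
  have E: "row_energy n m k \<alpha> g = 2 * \<alpha> - (real n + real m) - \<alpha> / 2 * real N +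
      ((\<Sum>t<n. 1 - g t) + (\<Sum>t<m. 1 + g (n + k + t)) + \<alpha> / 2 * (\<Sum>t\<in>R. d t))"
    unfolding row_energy_def A B N[symmetric] d_sum by (simp add: algebra_simps)
  have nn: "\<forall>t\<in>{..<n}. 0 \<le> 1 - g t" "\<forall>t\<in>{..<m}. 0 \<le> 1 + g (n + k + t)" "\<forall>t\<in>R. 0 \<le> d t"
  proof -
    show "\<forall>t\<in>{..<n}. 0 \<le> 1 - g t"
    proof
      fix t assume "t \<in> {..<n}" then show "0 \<le> 1 - g t" using sgn[of t] N by auto
    qed
    show "\<forall>t\<in>{..<m}. 0 \<le> 1 + g (n + k + t)"
    proof
      fix t assume "t \<in> {..<m}" then show "0 \<le> 1 + g (n + k + t)" using sgn[of "n + k + t"] N by auto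
    qed
    show "\<forall>t\<in>R. 0 \<le> d t" using val by (auto simp: R_def)
  qed
  let ?a = "\<Sum>t<n. 1 - g t" and ?b = "\<Sum>t<m. 1 + g (n + k + t)" and ?r = "\<Sum>t\<in>R. d t"
  have s: "0 \<le> ?a" "0 \<le> ?b" "0 \<le> ?r" using nn by (auto intro!: sum_nonneg)
  then show "2 * \<alpha> - (real n + real m) - \<alpha> / 2 * real N \<le> row_energy n m k \<alpha> g"
    unfolding E using \<alpha> by simp
  have "0 \<le> \<alpha> / 2 * ?r" using s \<alpha> by simp
  then have "row_energy n m k \<alpha> g = 2 * \<alpha> - (real n + real m) - \<alpha> / 2 * real N \<longleftrightarrow>
      ?a = 0 \<and> ?b = 0 \<and> \<alpha> / 2 * ?r = 0"
    unfolding E using s by linarith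
  also have "\<dots> \<longleftrightarrow> ?a = 0 \<and> ?b = 0 \<and> ?r = 0" using \<alpha> by simp
  also have "\<dots> \<longleftrightarrow> (\<forall>t<n. g t = 1) \<and> (\<forall>t<m. g (n + k + t) = -1) \<and> (\<forall>t\<in>R. d t = 0)"
  proof -
    have "?a = 0 \<longleftrightarrow> (\<forall>t<n. g t = 1)"
      using nn by (subst sum_nonneg_eq_0_iff) auto
    moreover have "?b = 0 \<longleftrightarrow> (\<forall>t<m. g (n + k + t) = -1)"
      using nn by (subst sum_nonneg_eq_0_iff) (auto simp: add_eq_0_iff)
    moreover have "?r = 0 \<longleftrightarrow> (\<forall>t\<in>R. d t = 0)"
      using nn by (intro sum_nonneg_eq_0_iff) (auto simp: R_def)
    ultimately show ?thesis by blast
  qed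
  also have "\<dots> \<longleftrightarrow> (\<exists>l\<le>k. \<exists>p\<le>k. \<forall>t<N. g t = band_row n m k l p t)"
  proof
    assume *: "(\<forall>t<n. g t = 1) \<and> (\<forall>t<m. g (n + k + t) = -1) \<and> (\<forall>t\<in>R. d t = 0)"
    have same: "g t = g (Suc t)" if "t < N" "t \<noteq> p" "t \<noteq> q" for t
    proof -
      have "d t = 0" using * that by (auto simp: R_def)
      then show ?thesis using val[OF that(1)] by (auto split: if_splits)
    qed
    \<comment> \<open>Position 0 lies in \<open>A\<close>, which fixes the sign up to
      \<open>p\<close>; the signs up to \<open>q\<close> and after \<open>q\<close> then follow from
      the two changes.\<close>
    have g0: "g 0 = 1" using * pos by simp
    have 1: "g t = 1" if "t \<le> p" for t
      using const_between[of 0 p g t] same that p q g0 by auto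
    have 2: "g t = g (Suc p)" if "p < t" "t \<le> q" for t
      using const_between[of "Suc p" q g t] same that p q by auto
    have gp: "g (Suc p) = -1"
      using sgn[of "Suc p"] 1[of p] p q by auto
    have "g (Suc q) = 1"
      using sgn[of "Suc q"] 2[of q] gp p q by auto
    then have 3: "g t = 1" if "q < t" "t \<le> N" for t
      using const_between[of "Suc q" N g t] same that p q by auto
    have p1: "n \<le> Suc p" using * gp by (metis not_le one_neq_neg_one)
    have gB: "g (n + k + t) = -1" if "t < m" for t using * that by simp
    have p2: "p < n + k" using 1[of "n + k"] gB[of 0] pos by force
    have "n + k \<le> q" using 3[of "n + k"] gB[of 0] pos N by force
    \<comment> \<open>If \<open>Suc q\<close> were still in \<open>B\<close>, the value there would
      be -1, against the change back to 1 at \<open>q\<close>.\<close>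
    have q1: "n + k + m \<le> Suc q"
    proof (rule ccontr)
      assume "\<not> ?thesis"
      then have "Suc q - (n + k) < m" "n + k + (Suc q - (n + k)) = Suc q"
        using \<open>n + k \<le> q\<close> by auto
      with gB[of "Suc q - (n + k)"] \<open>g (Suc q) = 1\<close> show False by simp
    qed
    \<comment> \<open>The parameters count the positions with value 1 in \<open>S\<^sub>1\<close>,
      from \<open>n\<close> to \<open>p\<close>, and in \<open>S\<^sub>2\<close>, from
      \<open>Suc q\<close> to \<open>N - 1\<close>.\<close>
    have "g t = band_row n m k (Suc p - n) (N - Suc q) t" if "t < N" for t
    proof (cases "t \<le> p \<or> q < t")
      case True
      then show ?thesis using 1 3 that p1 q p2 N by (auto simp: band_row_def)
    next
      case False
      then show ?thesis using 2[of t] gp that p1 q p2 N by (auto simp: band_row_def)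
    qed
    moreover have "Suc p - n \<le> k" "N - Suc q \<le> k" using p2 q1 N by auto
    ultimately show "\<exists>l\<le>k. \<exists>p\<le>k. \<forall>t<N. g t = band_row n m k l p t" by blast
  next
    assume "\<exists>l\<le>k. \<exists>p\<le>k. \<forall>t<N. g t = band_row n m k l p t"
    then obtain l r where lr: "l \<le> k" "r \<le> k" and g: "\<And>t. t < N \<Longrightarrow> g t = band_row n m k l r t"
      by blast
    \<comment> \<open>The formula extends to \<open>t = N\<close>: its second condition holds there,
      and \<open>g N = g 0 = 1\<close> because position 0 lies in \<open>A\<close>.\<close>
    have g': "g t = (if t < n + l \<or> N \<le> t + r then 1 else -1)" if "t \<le> N" for t
      using that g[of t] g[of 0] per pos N by (cases "t = N") (auto simp: band_row_def)
    have ch: "t = n + l - 1 \<or> t = N - r - 1" if "t < N" "g t \<noteq> g (Suc t)" for t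
      using that g'[of t] g'[of "Suc t"] by (auto split: if_splits)
    \<comment> \<open>A band can change sign at only two positions. The distinct changes
      \<open>p\<close> and \<open>q\<close> exhaust them, so none remains in
      \<open>R\<close>.\<close>
    have "p = n + l - 1 \<or> p = N - r - 1" "q = n + l - 1 \<or> q = N - r - 1" "p \<noteq> q"
      using ch p q by auto
    then have "t = p \<or> t = q" if "t < N" "g t \<noteq> g (Suc t)" for t
      using ch[OF that] by auto
    then have "\<forall>t\<in>R. d t = 0" using val by (auto simp: R_def)
    then show "(\<forall>t<n. g t = 1) \<and> (\<forall>t<m. g (n + k + t) = -1) \<and> (\<forall>t\<in>R. d t = 0)"
      using g' lr N by auto
  qed
  finally show "row_energy n m k \<alpha> g = 2 * \<alpha> - (real n + real m) - \<alpha> / 2 * real N \<longleftrightarrow>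
      (\<exists>l\<le>k. \<exists>p\<le>k. \<forall>t<N. g t = band_row n m k l p t)" .
qed

text \<open>The two alternatives overlap exactly at \<open>\<alpha> = n\<close>, where bands and
  constant rows are optimal together, so one predicate covers all cases of the theorem.\<close>

definition optimal_row :: "nat \<Rightarrow> nat \<Rightarrow> nat \<Rightarrow> real \<Rightarrow> (nat \<Rightarrow> real) \<Rightarrow> bool" where
  "optimal_row n m k \<alpha> g \<longleftrightarrow>
     \<alpha> \<le> real n \<and> (\<exists>l\<le>k. \<exists>p\<le>k. g = band_row n m k l p) \<or>
     real n \<le> \<alpha> \<and> (g = (\<lambda>_. -1) \<or> n = m \<and> g = (\<lambda>_. 1))"

text \<open>Constant rows are evaluated directly and the others are bounded by
  \<open>row_energy_nonconst\<close>; the smaller of the two losses decides which kind is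
  optimal.\<close>

lemma row_energy_ge:
  assumes sgn: "\<And>t. t \<le> N \<Longrightarrow> g t = 1 \<or> g t = (-1::real)" and N: "N = n + m + 2 * k"
    and per: "g N = g 0" and \<alpha>: "0 < \<alpha>" and pos: "0 < n" "n \<le> m"
  shows "row_min n m k \<alpha> \<le> row_energy n m k \<alpha> g"
    and "row_energy n m k \<alpha> g = row_min n m k \<alpha> \<longleftrightarrow>
      (\<exists>h. optimal_row n m k \<alpha> h \<and> (\<forall>t<N. g t = h t))"
proof -
  have opt: "(\<exists>h. optimal_row n m k \<alpha> h \<and> (\<forall>t<N. g t = h t)) \<longleftrightarrow>
     \<alpha> \<le> real n \<and> (\<exists>l\<le>k. \<exists>p\<le>k. \<forall>t<N. g t = band_row n m k l p t) \<or>
     real n \<le> \<alpha> \<and> ((\<forall>t<N. g t = -1) \<or> n = m \<and> (\<forall>t<N. g t = 1))"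
    unfolding optimal_row_def by blast
  \<comment> \<open>Position 0 lies in \<open>A\<close> and position \<open>n + k\<close> in
    \<open>B\<close>, where a band takes opposite values; hence no constant row is a band.\<close>
  have nonband: "\<not> (\<exists>l\<le>k. \<exists>p\<le>k. \<forall>t<N. g t = band_row n m k l p t)" if "g 0 = g (n + k)"
  proof
    assume "\<exists>l\<le>k. \<exists>p\<le>k. \<forall>t<N. g t = band_row n m k l p t"
    then obtain l p where "l \<le> k" "p \<le> k" "\<forall>t<N. g t = band_row n m k l p t" by blast
    then have "g 0 = 1" "g (n + k) = -1" using pos N by (auto simp: band_row_def)
    with that show False by simp
  qed
  let ?Q = "\<exists>l\<le>k. \<exists>p\<le>k. \<forall>t<N. g t = band_row n m k l p t"
  \<comment> \<open>\<open>X\<close> is the ideal energy without any loss. The constant rows -1 and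
    1 have energies \<open>X + 2 * n\<close> and \<open>X + 2 * m\<close>, a non-constant row at
    least \<open>X + 2 * \<alpha>\<close>.\<close>
  define X where "X = - (real n + real m) - \<alpha> / 2 * (real n + real m + 2 * real k)"
  have N': "real N = real n + real m + 2 * real k" unfolding N by simp
  have row_min: "row_min n m k \<alpha> = 2 * min \<alpha> (real n) + X"
    by (simp add: row_min_def X_def)
  have main: "row_min n m k \<alpha> \<le> row_energy n m k \<alpha> g \<and>
    (row_energy n m k \<alpha> g = row_min n m k \<alpha> \<longleftrightarrow>
      \<alpha> \<le> real n \<and> ?Q \<or>
     real n \<le> \<alpha> \<and> ((\<forall>t<N. g t = -1) \<or> n = m \<and> (\<forall>t<N. g t = 1)))"
  proof (cases "\<forall>t<N. g t = g 0")
    case True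
    with per have c: "g t = g 0" if "t \<le> N" for t
      using that by (metis le_neq_implies_less)
    have "0 < N" using N pos by simp
    have const: "(\<forall>t<N. g t = c) \<longleftrightarrow> g 0 = c" for c
      using True \<open>0 < N\<close> by metis
    have "row_energy n m k \<alpha> g = g 0 * (real m - real n) - \<alpha> / 2 * (real n + real m + 2 * real k)"
      using c[unfolded N] sgn[of 0] by (intro row_energy_const) blast+
    then have E: "row_energy n m k \<alpha> g = g 0 * (real m - real n) + (real n + real m) + X"
      by (simp add: X_def)
    have "n + k \<le> N" using N by simp
    then have nb: "\<not> ?Q"
      using nonband c[of "n + k"] by metis
    consider "g 0 = 1" | "g 0 = -1" using sgn[of 0] by auto
    then show ?thesis
    proof cases
      case 1
      show ?thesis
        unfolding E row_min const 1 using nb pos by (cases "\<alpha> \<le> real n") auto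
    next
      case 2
      show ?thesis
        unfolding E row_min const 2 using nb pos by (cases "\<alpha> \<le> real n") auto
    qed
  next
    case False
    then obtain y where y: "y < N" "g y \<noteq> g 0" by blast
    have nc: "(\<forall>t<N. g t = c) \<longleftrightarrow> False" for c
      using y by (metis gr_zeroI not_less_zero)
    have E: "2 * \<alpha> + X \<le> row_energy n m k \<alpha> g" "row_energy n m k \<alpha> g = 2 * \<alpha> + X \<longleftrightarrow> ?Q"
      using row_energy_nonconst[OF sgn N per \<alpha> y] pos unfolding X_def N' by (auto simp: diff_diff_eq)
    show ?thesis
    proof (cases "\<alpha> \<le> real n")
      case True
      then have "row_min n m k \<alpha> = 2 * \<alpha> + X" by (simp add: row_min)
      with E True show ?thesis unfolding nc by simp
    next
      case False
      then have "row_min n m k \<alpha> < 2 * \<alpha> + X" by (simp add: row_min)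
      then have "row_min n m k \<alpha> < row_energy n m k \<alpha> g" using E(1) by (rule less_le_trans)
      with False show ?thesis unfolding nc by simp
    qed
  qed
  then show "row_min n m k \<alpha> \<le> row_energy n m k \<alpha> g"
    by (rule conjunct1)
  from main show "row_energy n m k \<alpha> g = row_min n m k \<alpha> \<longleftrightarrow>
      (\<exists>h. optimal_row n m k \<alpha> h \<and> (\<forall>t<N. g t = h t))"
    unfolding opt by (rule conjunct2)
qed

section \<open>Distance to a strip\<close>

lemma torus_adj_succ:
  assumes "i \<in> {1..int N}" "j \<in> {1..int N}"
  shows "((i, j), (i, torus_succ N j)) \<in> torus_adj N"
    and "((i, torus_succ N j), (i, j)) \<in> torus_adj N"
    and "((i, j), (torus_succ N i, j)) \<in> torus_adj N"
  using assms assms[THEN torus_succ_mem]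
  by (simp_all add: torus_adj_def torus_vertices_def cyclic_neighbours_iff)

lemma torus_walk_right:
  assumes "0 < N" "i \<in> {1..int N}"
  shows "((i, torus_column N c s), (i, torus_column N c (s + r))) \<in> torus_adj N ^^ r"
  by (induction r) (use assms torus_adj_succ(1)[OF assms(2) torus_column_mem] in \<open>auto simp: torus_column_Suc\<close>)

lemma torus_walk_left:
  assumes "0 < N" "i \<in> {1..int N}"
  shows "((i, torus_column N c (s + r)), (i, torus_column N c s)) \<in> torus_adj N ^^ r"
proof (induction r)
  case (Suc r)
  have "((i, torus_column N c (s + Suc r)), (i, torus_column N c (s + r))) \<in> torus_adj N"
    using torus_adj_succ(2)[OF assms(2) torus_column_mem[OF assms(1)]] by (simp add: torus_column_Suc)
  then show ?case using Suc.IH by (rule relpow_Suc_I2)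
qed simp

lemma torus_column_0: "j \<in> {1..int N} \<Longrightarrow> torus_column N j 0 = j"
  by (simp add: torus_column_def)

text \<open>Walk along the row to the target column, then along that column. Existence of a walk
  ensures that the \<open>LEAST\<close> in \<open>torus_dist\<close> is attained.\<close>

lemma torus_connected:
  assumes "u \<in> torus_vertices N" "v \<in> torus_vertices N"
  shows "\<exists>r. (u, v) \<in> torus_adj N ^^ r"
proof -
  obtain i j i' j' where uv: "u = (i, j)" "v = (i', j')"
    and mem: "i \<in> {1..int N}" "j \<in> {1..int N}" "i' \<in> {1..int N}" "j' \<in> {1..int N}"
    using assms unfolding torus_vertices_def by blast
  have N: "0 < N" using mem by auto
  have "((i, j), (i, torus_column N j s)) \<in> (torus_adj N)\<^sup>*" for s
    using torus_walk_right[OF N mem(1), of j 0 s] torus_column_0[OF mem(2)]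
    by (metis add_0 relpow_imp_rtrancl)
  then have 1: "((i, j), (i, j')) \<in> (torus_adj N)\<^sup>*"
    by (metis torus_column_of_offset mem(4))
  \<comment> \<open>Here \<open>torus_column\<close> enumerates rows, starting from row
    \<open>i\<close>.\<close>
  have "((i, j'), (torus_column N i s, j')) \<in> (torus_adj N)\<^sup>*" for s
  proof (induction s)
    case 0 then show ?case by (simp add: torus_column_0[OF mem(1)])
  next
    case (Suc s)
    have "((torus_column N i s, j'), (torus_column N i (Suc s), j')) \<in> torus_adj N"
      unfolding torus_column_Suc using torus_column_mem[OF N] mem(4) by (rule torus_adj_succ(3))
    with Suc.IH show ?case by (rule rtrancl_into_rtrancl)
  qed
  then have "((i, j'), (i', j')) \<in> (torus_adj N)\<^sup>*"
    by (metis torus_column_of_offset mem(3))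
  with 1 have "(u, v) \<in> (torus_adj N)\<^sup>*" unfolding uv by (rule rtrancl_trans)
  then show ?thesis by (rule rtrancl_imp_relpow)
qed

text \<open>Distance on a cycle of length \<open>N\<close> from position \<open>t\<close> to the
  interval of positions below \<open>n\<close>: \<open>Suc t - n\<close> steps back to its last
  position, or \<open>N - t\<close> steps forward to position 0.\<close>

definition offset_dist :: "nat \<Rightarrow> nat \<Rightarrow> nat \<Rightarrow> nat" where
  "offset_dist N n t = (if t < n then 0 else min (Suc t - n) (N - t))"

text \<open>A step of a walk changes \<open>offset_dist\<close> by at most one, which bounds graph distances from
  below.\<close>

lemma offset_dist_torus_adj:
  assumes "((i, j), (i', j')) \<in> torus_adj N" "0 < n"
  shows "offset_dist N n (nat ((j - c) mod int N)) \<le> Suc (offset_dist N n (nat ((j' - c) mod int N)))"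
proof -
  have *: "offset_dist N n (nat ((x - c) mod int N)) \<le> Suc (offset_dist N n (nat ((torus_succ N x - c) mod int N)))
     \<and> offset_dist N n (nat ((torus_succ N x - c) mod int N)) \<le> Suc (offset_dist N n (nat ((x - c) mod int N)))"
    if x: "x \<in> {1..int N}" for x
  proof -
    define t where "t = nat ((x - c) mod int N)"
    have t: "t < N" "x = torus_column N c t"
      using x by (auto simp: t_def nat_less_iff torus_column_of_offset)
    have "torus_succ N x = torus_column N c (if Suc t = N then 0 else Suc t)"
      using t by (simp add: torus_column_period flip: torus_column_Suc)
    then have "nat ((torus_succ N x - c) mod int N) = (if Suc t = N then 0 else Suc t)"
      using t by (simp add: torus_column_offset)
    then show ?thesis
      unfolding t_def[symmetric] using t assms(2) by (auto simp: offset_dist_def)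
  qed
  have "j \<in> {1..int N}" "j' \<in> {1..int N}"
    and "j = j' \<or> j' = torus_succ N j \<or> j = torus_succ N j'"
    using assms by (auto simp: torus_adj_def torus_vertices_def cyclic_neighbours_iff)
  then show ?thesis using *[of j] *[of j'] by auto
qed

lemma offset_dist_walk:
  assumes "(u, v) \<in> torus_adj N ^^ r" "0 < n"
  shows "offset_dist N n (nat ((snd u - c) mod int N)) \<le> r + offset_dist N n (nat ((snd v - c) mod int N))"
  using assms(1)
proof (induction r arbitrary: v)
  case (Suc r)
  then obtain w where w: "(u, w) \<in> torus_adj N ^^ r" "(w, v) \<in> torus_adj N" by auto
  have "offset_dist N n (nat ((snd w - c) mod int N)) \<le> Suc (offset_dist N n (nat ((snd v - c) mod int N)))"
    using offset_dist_torus_adj[of "fst w" "snd w" "fst v" "snd v"] w(2) assms(2) by simp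
  with Suc.IH[OF w(1)] show ?case by simp
qed simp

text \<open>A horizontal walk to the nearer end of the strip gives the upper bound. The lower bound
  holds since \<open>offset_dist\<close> vanishes on the strip and drops by at most one per
  step.\<close>

lemma torus_setdist_strip:
  assumes i: "i \<in> {1..int N}" and t: "t < N" and n: "0 < n" "n \<le> N"
  shows "torus_setdist N (i, torus_column N c t) (strip N c n) = offset_dist N n t"
proof -
  let ?u = "(i, torus_column N c t)"
  have N: "0 < N" using t by simp
  have strip: "v \<in> strip N c n \<longleftrightarrow> (\<exists>x\<in>{1..int N}. \<exists>s<n. v = (x, torus_column N c s))" for v
    using n N by (auto simp: strip_eq)
  have "\<exists>w\<in>strip N c n. (?u, w) \<in> torus_adj N ^^ offset_dist N n t"
  proof -
    consider "t < n" | "n \<le> t" "Suc t - n \<le> N - t" | "n \<le> t" "N - t \<le> Suc t - n" by linarith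
    then show ?thesis
    proof cases
      case 1
      then show ?thesis using i by (auto simp: strip offset_dist_def)
    next
      case 2
      have "(?u, (i, torus_column N c (n - 1))) \<in> torus_adj N ^^ (Suc t - n)"
        using torus_walk_left[OF N i, of c "n - 1" "Suc t - n"] 2 n by simp
      moreover have "(i, torus_column N c (n - 1)) \<in> strip N c n"
        using i n by (metis strip diff_less zero_less_one)
      ultimately show ?thesis using 2 by (auto simp: offset_dist_def)
    next
      case 3
      have "(?u, (i, torus_column N c 0)) \<in> torus_adj N ^^ (N - t)"
        using torus_walk_right[OF N i, of c t "N - t"] t by (simp add: torus_column_period)
      moreover have "(i, torus_column N c 0) \<in> strip N c n"
        using i n by (metis strip)
      ultimately show ?thesis using 3 by (auto simp: offset_dist_def)
    qed
  qed
  then obtain w where w: "w \<in> strip N c n" "torus_dist N ?u w \<le> offset_dist N n t"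
    unfolding torus_dist_def by (metis Least_le)
  have "offset_dist N n t \<le> torus_dist N ?u v" if v: "v \<in> strip N c n" for v
  proof -
    have mem: "?u \<in> torus_vertices N" "v \<in> torus_vertices N"
      using i torus_column_mem[OF N] v by (auto simp: torus_vertices_def strip_def)
    have "(?u, v) \<in> torus_adj N ^^ torus_dist N ?u v"
      unfolding torus_dist_def using torus_connected[OF mem] by (rule LeastI_ex)
    from offset_dist_walk[OF this n(1), of c]
    have "offset_dist N n t \<le> torus_dist N ?u v + offset_dist N n (nat ((snd v - c) mod int N))"
      using t by (simp add: torus_column_offset)
    moreover have "nat ((snd v - c) mod int N) < n"
      using v n by (auto simp: strip_def nat_less_iff)
    ultimately show ?thesis by (simp add: offset_dist_def)
  qed
  with w show ?thesis
    unfolding torus_setdist_def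
    by (intro antisym cINF_greatest) (auto intro: cINF_lower2)
qed

section \<open>Strips and enlarged strips in terms of positions\<close>

lemma torus_column_mem_strip:
  assumes "i \<in> {1..int N}" "t < N" "d + w \<le> N"
  shows "(i, torus_column N c t) \<in> strip N (c + int d) w \<longleftrightarrow> d \<le> t \<and> t < d + w"
proof -
  have "(i, torus_column N c t) \<in> strip N (c + int d) w \<longleftrightarrow>
      (\<exists>s<w. torus_column N c t = torus_column N c (d + s))"
    using assms by (auto simp: strip_eq torus_column_shift image_iff)
  also have "\<dots> \<longleftrightarrow> (\<exists>s<w. t = d + s)"
  proof -
    have "torus_column N c t = torus_column N c (d + s) \<longleftrightarrow> t = d + s" if "s < w" for s
      using inj_on_eq_iff[OF inj_on_torus_column, of t N "d + s" c] that assms by simp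
    then show ?thesis by blast
  qed
  also have "\<dots> \<longleftrightarrow> d \<le> t \<and> t < d + w"
    by (metis le_add1 le_add_diff_inverse nat_add_left_cancel_less)
  finally show ?thesis .
qed

text \<open>In \<open>S\<^sub>1\<close> the way back to \<open>A\<close> takes at most
  \<open>k\<close> steps and the way forward more than \<open>k\<close>; in \<open>S\<^sub>2\<close>
  it is the reverse. So the minimum in \<open>offset_dist\<close> is \<open>Suc t - n\<close> and
  \<open>N - t\<close> respectively.\<close>

lemma torus_column_mem_enlarged:
  assumes i: "i \<in> {1..int N}" and t: "t < N" and N: "N = n + m + 2 * k" and n: "0 < n"
    and lp: "l \<le> k" "p \<le> k"
  shows "(i, torus_column N c t) \<in> enlarged N (strip N c n) (strip N (c + int n) k)
      (strip N (c + int n + int k + int m) k) l p \<longleftrightarrow> t < n + l \<or> N \<le> t + p"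
proof -
  have A: "(i, torus_column N c t) \<in> strip N c n \<longleftrightarrow> t < n"
    using torus_column_mem_strip[OF i t, of 0 n c] N by simp
  have S1: "(i, torus_column N c t) \<in> strip N (c + int n) k \<longleftrightarrow> n \<le> t \<and> t < n + k"
    using torus_column_mem_strip[OF i t, of n k c] N by simp
  have S2: "(i, torus_column N c t) \<in> strip N (c + int n + int k + int m) k \<longleftrightarrow> n + k + m \<le> t"
    using torus_column_mem_strip[OF i t, of "n + k + m" k c] N t by (simp add: add.assoc)
  have dist: "torus_setdist N (i, torus_column N c t) (strip N c n) = offset_dist N n t"
    using N by (intro torus_setdist_strip i t n) simp
  show ?thesis
    unfolding enlarged_def Un_iff mem_Collect_eq A S1 S2 dist offset_dist_def
    using t N lp by (auto simp: min_def)
qed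

section \<open>Minimisers of the Hamiltonian\<close>

text \<open>All rows equal \<open>h\<close>, read from column \<open>c\<close>. Restricting to the
  vertices makes the function extensional, so equality of configurations can be checked on vertices
  alone.\<close>

definition column_config :: "nat \<Rightarrow> int \<Rightarrow> (nat \<Rightarrow> real) \<Rightarrow> int \<times> int \<Rightarrow> real" where
  "column_config N c h = (\<lambda>v\<in>torus_vertices N. h (nat ((snd v - c) mod int N)))"

lemma column_config_column:
  assumes "i \<in> {1..int N}" "t < N"
  shows "column_config N c h (i, torus_column N c t) = h t"
  using assms torus_column_mem[of N c t]
  by (simp add: column_config_def torus_vertices_def torus_column_offset)

lemma column_config_eqI:
  assumes "\<sigma> \<in> extensional (torus_vertices N)"
    and "\<And>i t. i \<in> {1..int N} \<Longrightarrow> t < N \<Longrightarrow> \<sigma> (i, torus_column N c t) = h t"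
  shows "\<sigma> = column_config N c h"
proof (rule extensionalityI[OF assms(1)])
  fix v assume "v \<in> torus_vertices N"
  then obtain i j where v: "v = (i, j)" "i \<in> {1..int N}" "j \<in> {1..int N}"
    by (auto simp: torus_vertices_def)
  then have "nat ((j - c) mod int N) < N" by (simp add: nat_less_iff)
  with v show "\<sigma> v = column_config N c h v"
    using assms(2)[of i "nat ((j - c) mod int N)"] column_config_column[of i N "nat ((j - c) mod int N)" c h]
    by (simp add: torus_column_of_offset)
qed (simp add: column_config_def)

lemma const_config_eq: "const_config N x = column_config N c (\<lambda>_. x)"
  by (simp add: const_config_def column_config_def)

lemma set_config_enlarged_eq:
  assumes N: "N = n + m + 2 * k" and "0 < n" "l \<le> k" "p \<le> k"
  shows "set_config N (enlarged N (strip N c n) (strip N (c + int n) k)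
      (strip N (c + int n + int k + int m) k) l p) = column_config N c (band_row n m k l p)"
proof (rule column_config_eqI)
  fix i t assume i: "i \<in> {1..int N}" and t: "t < N"
  then have "(i, torus_column N c t) \<in> torus_vertices N"
    using torus_column_mem[of N c t] by (simp add: torus_vertices_def)
  then show "set_config N (enlarged N (strip N c n) (strip N (c + int n) k)
      (strip N (c + int n + int k + int m) k) l p) (i, torus_column N c t) = band_row n m k l p t"
    unfolding set_config_def band_row_def N[symmetric]
    by (simp add: torus_column_mem_enlarged[OF i t assms])
qed (simp add: set_config_def)

section \<open>Splitting the Hamiltonian into rows and minimising it\<close>

lemma hamiltonian_eq_sum_rows:
  assumes N: "N = n + m + 2 * k" "3 \<le> N"
  shows "hamiltonian N (strip N c n) (strip N (c + int n + int k) m) \<alpha> \<sigma> =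
    (\<Sum>i\<in>{1..int N}. row_energy n m k \<alpha> (\<lambda>t. \<sigma> (i, torus_column N c t))
       - \<alpha> / 2 * (\<Sum>j\<in>{1..int N}. \<sigma> (i, j) * \<sigma> (torus_succ N i, j)))"
proof -
  let ?I = "{1..int N}"
  have "0 < N" using N(2) by simp
  have A: "(\<Sum>v\<in>strip N c n. \<sigma> v) = (\<Sum>i\<in>?I. \<Sum>t<n. \<sigma> (i, torus_column N c t))"
    using N by (intro sum_strip) auto
  have "(\<Sum>v\<in>strip N (c + int (n + k)) m. \<sigma> v) =
      (\<Sum>i\<in>?I. \<Sum>t<m. \<sigma> (i, torus_column N (c + int (n + k)) t))"
    using N by (intro sum_strip) auto
  then have B: "(\<Sum>v\<in>strip N (c + int n + int k) m. \<sigma> v) =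
      (\<Sum>i\<in>?I. \<Sum>t<m. \<sigma> (i, torus_column N c (n + k + t)))"
    unfolding torus_column_shift by (simp add: add.assoc)
  \<comment> \<open>An edge has two distinct endpoints by \<open>torus_succ_neq\<close>, so the
    product over the edge is the product of the two end values.\<close>
  have "(\<Sum>e\<in>torus_edges N. \<Prod>v\<in>e. \<sigma> v) =
      (\<Sum>i\<in>?I. \<Sum>j\<in>?I. \<sigma> (i, j) * \<sigma> (i, torus_succ N j)) +
      (\<Sum>i\<in>?I. \<Sum>j\<in>?I. \<sigma> (i, j) * \<sigma> (torus_succ N i, j))"
    unfolding sum_torus_edges[OF N(2)]
    using N torus_succ_neq[of _ N] by (intro arg_cong2[where f = "(+)"] sum.cong refl) (simp_all add: neq_commute)
  also have "(\<Sum>i\<in>?I. \<Sum>j\<in>?I. \<sigma> (i, j) * \<sigma> (i, torus_succ N j)) =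
      (\<Sum>i\<in>?I. \<Sum>t<n + m + 2 * k. \<sigma> (i, torus_column N c t) * \<sigma> (i, torus_column N c (Suc t)))"
    unfolding sum_torus_columns[OF \<open>0 < N\<close>, of _ c] torus_column_Suc N(1)[symmetric] ..
  finally have D: "(\<Sum>e\<in>torus_edges N. \<Prod>v\<in>e. \<sigma> v) =
      (\<Sum>i\<in>?I. \<Sum>t<n + m + 2 * k. \<sigma> (i, torus_column N c t) * \<sigma> (i, torus_column N c (Suc t))) +
      (\<Sum>i\<in>?I. \<Sum>j\<in>?I. \<sigma> (i, j) * \<sigma> (torus_succ N i, j))" .
  show ?thesis
    unfolding hamiltonian_def A B D row_energy_def
    by (simp add: sum.distrib sum_subtractf sum_negf distrib_left sum_distrib_left sum_divide_distrib)
qed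

lemma optimal_row_values: "optimal_row n m k \<alpha> h \<Longrightarrow> h t = 1 \<or> h t = -1"
  unfolding optimal_row_def by (elim disjE conjE exE) (simp_all add: band_row_def)

lemma exists_optimal_row: "\<exists>h. optimal_row n m k \<alpha> h"
  unfolding optimal_row_def by (metis linear le_refl)

lemma config_values:
  assumes "\<sigma> \<in> configs N" "i \<in> {1..int N}" "j \<in> {1..int N}"
  shows "\<sigma> (i, j) = 1 \<or> \<sigma> (i, j) = -1"
proof -
  have "\<sigma> (i, j) \<in> {-1, 1}"
    using assms unfolding configs_def torus_vertices_def by (blast intro: PiE_mem)
  then show ?thesis by auto
qed

lemma column_config_mem: "optimal_row n m k \<alpha> h \<Longrightarrow> column_config N c h \<in> configs N"
  using optimal_row_values[of n m k \<alpha> h] by (auto simp: configs_def column_config_def)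

text \<open>Each of the \<open>N\<close> rows contributes \<open>row_min\<close> and is charged with
  \<open>N\<close> vertical edges, each of energy at least \<open>- \<alpha> / 2\<close>.\<close>

definition config_min :: "nat \<Rightarrow> nat \<Rightarrow> nat \<Rightarrow> nat \<Rightarrow> real \<Rightarrow> real" where
  "config_min N n m k \<alpha> = real N * (row_min n m k \<alpha> - \<alpha> / 2 * real N)"

text \<open>The row energies and the vertical edges are bounded separately. Both bounds are met
  together exactly when all rows agree and their common row is optimal.\<close>

lemma hamiltonian_ge:
  fixes c :: int
  assumes N: "N = n + m + 2 * k" "3 \<le> N" and nm: "0 < n" "n \<le> m" and \<alpha>: "0 < \<alpha>"
    and \<sigma>: "\<sigma> \<in> configs N"
  defines "E \<equiv> hamiltonian N (strip N c n) (strip N (c + int n + int k) m) \<alpha> \<sigma>"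
  shows "config_min N n m k \<alpha> \<le> E"
    and "E = config_min N n m k \<alpha> \<longleftrightarrow> (\<exists>h. optimal_row n m k \<alpha> h \<and> \<sigma> = column_config N c h)"
proof -
  let ?I = "{1..int N}"
  define r where "r i = row_energy n m k \<alpha> (\<lambda>t. \<sigma> (i, torus_column N c t))" for i
  \<comment> \<open>The edges from row \<open>i\<close> to its successor are charged to row
    \<open>i\<close>; the sign turns agreement into the termwise minimum -1.\<close>
  define w where "w i = (\<Sum>j\<in>?I. - (\<sigma> (i, j) * \<sigma> (torus_succ N i, j)))" for i
  have N0: "0 < N" using N(2) by simp
  have "E = (\<Sum>i\<in>?I. r i - \<alpha> / 2 * (\<Sum>j\<in>?I. \<sigma> (i, j) * \<sigma> (torus_succ N i, j)))"
    unfolding E_def r_def by (rule hamiltonian_eq_sum_rows[OF N])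
  then have E: "E = (\<Sum>i\<in>?I. r i + \<alpha> / 2 * w i)"
    by (simp add: w_def sum_negf)
  have val: "\<sigma> (i, j) = 1 \<or> \<sigma> (i, j) = -1" if "i \<in> ?I" "j \<in> ?I" for i j
    using config_values[OF \<sigma> that] .
  have r: "row_min n m k \<alpha> \<le> r i"
    "r i = row_min n m k \<alpha> \<longleftrightarrow> (\<exists>h. optimal_row n m k \<alpha> h \<and> (\<forall>t<N. \<sigma> (i, torus_column N c t) = h t))"
    if i: "i \<in> ?I" for i
    unfolding r_def
    by (rule row_energy_ge[OF _ N(1) _ \<alpha> nm];
        simp add: torus_column_period val[OF i torus_column_mem[OF N0]])+
  have w: "- real N \<le> w i"
    "w i = - real N \<longleftrightarrow> (\<forall>j\<in>?I. \<sigma> (i, j) = \<sigma> (torus_succ N i, j))"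
    if i: "i \<in> ?I" for i
  proof -
    have eq: "- (\<sigma> (i, j) * \<sigma> (torus_succ N i, j)) = -1 \<longleftrightarrow> \<sigma> (i, j) = \<sigma> (torus_succ N i, j)"
      and ge: "-1 \<le> - (\<sigma> (i, j) * \<sigma> (torus_succ N i, j))" if "j \<in> ?I" for j
      using val[OF i that] val[OF torus_succ_mem[OF i] that] by auto
    note sum_le_eq_iff[of ?I "-1" "\<lambda>j. - (\<sigma> (i, j) * \<sigma> (torus_succ N i, j))",
        OF finite_atLeastAtMost_int ge]
    then have "- real N \<le> w i"
      and "w i = - real N \<longleftrightarrow> (\<forall>j\<in>?I. - (\<sigma> (i, j) * \<sigma> (torus_succ N i, j)) = -1)"
      by (simp_all add: w_def)
    moreover have "(\<forall>j\<in>?I. - (\<sigma> (i, j) * \<sigma> (torus_succ N i, j)) = -1) \<longleftrightarrow>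
        (\<forall>j\<in>?I. \<sigma> (i, j) = \<sigma> (torus_succ N i, j))"
      by (intro ball_cong refl eq)
    ultimately show "- real N \<le> w i"
      "w i = - real N \<longleftrightarrow> (\<forall>j\<in>?I. \<sigma> (i, j) = \<sigma> (torus_succ N i, j))"
      by simp_all
  qed
  define b where "b = row_min n m k \<alpha> - \<alpha> / 2 * real N"
  have row: "b \<le> r i + \<alpha> / 2 * w i"
    "r i + \<alpha> / 2 * w i = b \<longleftrightarrow> r i = row_min n m k \<alpha> \<and> w i = - real N" if i: "i \<in> ?I" for i
  proof -
    have "\<alpha> / 2 * w i \<ge> \<alpha> / 2 * (- real N)"
      using w(1)[OF i] \<alpha> by (intro mult_left_mono) auto
    moreover have "\<alpha> / 2 * w i = \<alpha> / 2 * (- real N) \<longleftrightarrow> w i = - real N"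
      using \<alpha> unfolding mult_cancel_left by simp
    ultimately show "b \<le> r i + \<alpha> / 2 * w i"
      "r i + \<alpha> / 2 * w i = b \<longleftrightarrow> r i = row_min n m k \<alpha> \<and> w i = - real N"
      using r(1)[OF i] unfolding b_def by linarith+
  qed
  have cm: "real (card ?I) * b = config_min N n m k \<alpha>"
    by (simp add: b_def config_min_def)
  note total = sum_le_eq_iff[of ?I b "\<lambda>i. r i + \<alpha> / 2 * w i", OF _ row(1), simplified cm E[symmetric]]
  show "config_min N n m k \<alpha> \<le> E" using total(1) by simp
  have "E = config_min N n m k \<alpha> \<longleftrightarrow> (\<forall>i\<in>?I. r i = row_min n m k \<alpha> \<and> w i = - real N)"
    using total(2) row(2) by simp
  also have "\<dots> \<longleftrightarrow> (\<exists>h. optimal_row n m k \<alpha> h \<and> \<sigma> = column_config N c h)"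
  proof
    assume *: "\<forall>i\<in>?I. r i = row_min n m k \<alpha> \<and> w i = - real N"
    have vert: "\<sigma> (i, j) = \<sigma> (torus_succ N i, j)" if "i \<in> ?I" "j \<in> ?I" for i j
      using w(2)[OF that(1)] * that by blast
    have one: "(1::int) \<in> ?I" using N0 by simp
    obtain h where h: "optimal_row n m k \<alpha> h" "\<forall>t<N. \<sigma> (1, torus_column N c t) = h t"
      using r(2)[OF one] * one by blast
    \<comment> \<open>Agreement of successive rows propagates from row 1 to every row, so the
      optimal row \<open>h\<close> found in row 1 describes the whole configuration.\<close>
    have col: "\<sigma> (torus_column N 1 s, j) = \<sigma> (1, j)" if "j \<in> ?I" for s j
    proof (induction s)
      case 0 then show ?case using torus_column_0[OF one] by simp
    next
      case (Suc s)
      then show ?case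
        unfolding torus_column_Suc using vert[OF torus_column_mem[OF N0, of 1 s] that] by simp
    qed
    have "\<sigma> = column_config N c h"
    proof (rule column_config_eqI)
      show "\<sigma> \<in> extensional (torus_vertices N)"
        using \<sigma> by (simp add: configs_def PiE_def)
      fix i t assume i: "i \<in> ?I" and t: "t < N"
      have "\<sigma> (i, torus_column N c t) = \<sigma> (1, torus_column N c t)"
        using col[OF torus_column_mem[OF N0]] torus_column_of_offset[OF i, of 1] by metis
      then show "\<sigma> (i, torus_column N c t) = h t" using h(2) t by simp
    qed
    with h(1) show "\<exists>h. optimal_row n m k \<alpha> h \<and> \<sigma> = column_config N c h" by blast
  next
    assume "\<exists>h. optimal_row n m k \<alpha> h \<and> \<sigma> = column_config N c h"
    then obtain h where h: "optimal_row n m k \<alpha> h" and eq: "\<sigma> = column_config N c h" by blast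
    show "\<forall>i\<in>?I. r i = row_min n m k \<alpha> \<and> w i = - real N"
    proof
      fix i assume i: "i \<in> ?I"
      have "r i = row_min n m k \<alpha>"
        unfolding r(2)[OF i] using h column_config_column[OF i] eq by blast
      moreover have "w i = - real N"
        unfolding w(2)[OF i] using i torus_succ_mem[OF i]
        by (simp add: eq column_config_def torus_vertices_def)
      ultimately show "r i = row_min n m k \<alpha> \<and> w i = - real N" ..
    qed
  qed
  finally show "E = config_min N n m k \<alpha> \<longleftrightarrow> (\<exists>h. optimal_row n m k \<alpha> h \<and> \<sigma> = column_config N c h)" .
qed

text \<open>An optimal row exists for every \<open>\<alpha>\<close>, so the lower bound of
  \<open>hamiltonian_ge\<close> is attained and the stable configurations are those in its equality
  case.\<close>

lemma
  assumes N: "N = n + m + 2 * k" "3 \<le> N" and nm: "0 < n" "n \<le> m" and \<alpha>: "0 < \<alpha>"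
  shows Min_hamiltonian:
      "Min (hamiltonian N (strip N c n) (strip N (c + int n + int k) m) \<alpha> ` configs N) = config_min N n m k \<alpha>"
    and stable_configs_eq:
      "stable_configs N (strip N c n) (strip N (c + int n + int k) m) \<alpha> =
        {column_config N c h | h. optimal_row n m k \<alpha> h}"
proof -
  let ?H = "hamiltonian N (strip N c n) (strip N (c + int n + int k) m) \<alpha>"
  note ge = hamiltonian_ge[OF N nm \<alpha>, of _ c]
  obtain h where h: "optimal_row n m k \<alpha> h" using exists_optimal_row by blast
  have mem: "column_config N c h \<in> configs N" using h by (rule column_config_mem)
  have att: "?H (column_config N c h) = config_min N n m k \<alpha>"
    using ge(2)[OF mem] h by blast
  have "finite (configs N)"
    unfolding configs_def torus_vertices_def by (intro finite_PiE) auto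
  then show "Min (?H ` configs N) = config_min N n m k \<alpha>"
    using ge(1) mem att by (intro Min_eqI) (auto intro: rev_image_eqI)
  have "\<sigma> \<in> stable_configs N (strip N c n) (strip N (c + int n + int k) m) \<alpha> \<longleftrightarrow>
      \<sigma> \<in> configs N \<and> ?H \<sigma> = config_min N n m k \<alpha>" for \<sigma>
    unfolding stable_configs_def mem_Collect_eq using ge(1) mem att by (metis antisym)
  then show "stable_configs N (strip N c n) (strip N (c + int n + int k) m) \<alpha> =
        {column_config N c h | h. optimal_row n m k \<alpha> h}"
    using ge(2) column_config_mem[of n m k \<alpha> _ N c] by blast
qed

section \<open>Minimum and stable configurations for each range of the coupling\<close>

theorem theorem2p1:
  fixes N n m k :: nat and a :: int and \<alpha> :: real
    and A S\<^sub>1 B S\<^sub>2 :: "(int \<times> int) set"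
  assumes "even N" and "N = n + m + 2 * k"
    and "3 \<le> n" and "n \<le> m" and "1 \<le> k" and "real k < real N / 2"
    and "1 \<le> a" and "a \<le> int N"
    and "A = strip N a n"
    and "S\<^sub>1 = strip N (a + int n) k"
    and "B = strip N (a + int n + int k) m"
    and "S\<^sub>2 = strip N (a + int n + int k + int m) k"
    and "\<alpha> > 0"
  shows
    "(2 \<le> \<alpha> \<and> \<alpha> < real n \<longrightarrow>
        Min (hamiltonian N A B \<alpha> ` configs N)
          = - real N * (real n + real m) + 2 * \<alpha> * real N - \<alpha> * (real N)^2) \<and>
     (\<alpha> \<ge> real n \<longrightarrow>
        Min (hamiltonian N A B \<alpha> ` configs N)
          = real N * (real n - real m) - \<alpha> * (real N)^2) \<and>
     (2 \<le> \<alpha> \<and> \<alpha> < real n \<longrightarrow>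
        stable_configs N A B \<alpha>
          = {set_config N (enlarged N A S\<^sub>1 S\<^sub>2 l p) | l p. l \<le> k \<and> p \<le> k}) \<and>
     (\<alpha> = real n \<and> n = m \<longrightarrow>
        stable_configs N A B \<alpha>
          = {const_config N (-1), const_config N 1}
            \<union> {set_config N (enlarged N A S\<^sub>1 S\<^sub>2 l p) | l p. l \<le> k \<and> p \<le> k}) \<and>
     (\<alpha> = real n \<and> n < m \<longrightarrow>
        stable_configs N A B \<alpha>
          = {const_config N (-1)}
            \<union> {set_config N (enlarged N A S\<^sub>1 S\<^sub>2 l p) | l p. l \<le> k \<and> p \<le> k}) \<and>
     (\<alpha> \<ge> real m + 1 \<and> n = m \<longrightarrow>
        stable_configs N A B \<alpha> = {const_config N (-1), const_config N 1}) \<and>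
     (\<alpha> \<ge> real m + 1 \<and> n < m \<longrightarrow>
        stable_configs N A B \<alpha> = {const_config N (-1)})"
proof -
  have N: "N = n + m + 2 * k" "3 \<le> N" and nm: "0 < n" "n \<le> m" and \<alpha>: "0 < \<alpha>"
    using assms by auto
  have rN: "real N = real n + real m + 2 * real k" using N by simp
  have min: "Min (hamiltonian N A B \<alpha> ` configs N) = config_min N n m k \<alpha>"
    using Min_hamiltonian[OF N nm \<alpha>, of a] assms by simp
  have stable: "stable_configs N A B \<alpha> = {column_config N a h | h. optimal_row n m k \<alpha> h}"
    using stable_configs_eq[OF N nm \<alpha>, of a] assms by simp
  \<comment> \<open>With bands and constants both written as \<open>column_config\<close>, the cases
    below only ask which alternatives of \<open>optimal_row\<close> survive.\<close>
  have bands: "{set_config N (enlarged N A S\<^sub>1 S\<^sub>2 l p) | l p. l \<le> k \<and> p \<le> k} =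
      {column_config N a (band_row n m k l p) | l p. l \<le> k \<and> p \<le> k}"
    using set_config_enlarged_eq[OF N(1) nm(1), of _ _ a] assms by metis
  have min1: "config_min N n m k \<alpha> = - real N * (real n + real m) + 2 * \<alpha> * real N - \<alpha> * (real N)\<^sup>2"
    if "\<alpha> < real n"
    using that unfolding config_min_def row_min_def rN[symmetric]
    by (simp add: power2_eq_square algebra_simps)
  have min2: "config_min N n m k \<alpha> = real N * (real n - real m) - \<alpha> * (real N)\<^sup>2"
    if "real n \<le> \<alpha>"
    using that unfolding config_min_def row_min_def rN[symmetric]
    by (simp add: power2_eq_square algebra_simps)
  have st1: "stable_configs N A B \<alpha> =
      {column_config N a (band_row n m k l p) | l p. l \<le> k \<and> p \<le> k}" if "\<alpha> < real n"
    unfolding stable optimal_row_def using that by auto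
  have st2: "stable_configs N A B \<alpha> =
      {column_config N a (\<lambda>_. - 1), column_config N a (\<lambda>_. 1)} \<union>
      {column_config N a (band_row n m k l p) | l p. l \<le> k \<and> p \<le> k}" if "\<alpha> = real n" "n = m"
    unfolding stable optimal_row_def using that by auto
  have st3: "stable_configs N A B \<alpha> =
      {column_config N a (\<lambda>_. - 1)} \<union>
      {column_config N a (band_row n m k l p) | l p. l \<le> k \<and> p \<le> k}" if "\<alpha> = real n" "n < m"
    unfolding stable optimal_row_def using that by auto
  \<comment> \<open>From \<open>\<alpha> \<ge> m + 1\<close> and \<open>n \<le> m\<close> follows
    \<open>\<alpha> > n\<close>, which rules out the bands.\<close>
  have st4: "stable_configs N A B \<alpha> =
      {column_config N a (\<lambda>_. - 1), column_config N a (\<lambda>_. 1)}" if "real m + 1 \<le> \<alpha>" "n = m"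
    unfolding stable optimal_row_def using that by auto
  have st5: "stable_configs N A B \<alpha> = {column_config N a (\<lambda>_. - 1)}"
    if "real m + 1 \<le> \<alpha>" "n < m"
    unfolding stable optimal_row_def using that by auto
  show ?thesis
    unfolding min bands const_config_eq[of N _ a]
    by (intro conjI impI; (elim conjE)?; rule min1 min2 st1 st2 st3 st4 st5; assumption)
qed

end
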